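(* Fix a finite sample $C_1,\dots,C_n\in\mathcal C$ with $n\ge2$. Assume that the arc-length probability measure $\mu_C$ is defined for every $C\in\mathcal C$ and that for every Borel set $B\subseteq\mathbb R^2$ the map $C\mapsto\mu_C(B)$ is measurable with respect to the $\sigma$-algebra on $\mathcal C$ induced by $\Phi$. Then the four depth maps $C\mapsto D_{\mathrm{int}}(C\mid\{C_i\})$, $C\mapsto D_{\mathrm{inf}}(C\mid\{C_i\})$, $C\mapsto D_{\mathrm{FW}}(C\mid\{C_i\})$ and $C\mapsto D_{\mathrm{FW}}^{\inf}(C\mid\{C_i\})$ are Borel-measurable with respect to the same $\sigma$-algebra.
   Context: Curve space. Let $\mathbb S^1=[0,1]/\{0\sim1\}$ and $I\in\{[0,1],\mathbb S^1\}$. $\mathcal F(I)$ is the set of continuous maps $f:I\to\mathbb R^2$ of finite length $L(f)=\sup\sum_j\|f(\tau_j)-f(\tau_{j-1})\|_2$ (supremum over partitions $0=\tau_0<\dots<\tau_J=1$) whose arc-length map $s_f(t)=L(f|_{[0,t]})$ is strictly increasing (for $I=\mathbb S^1$, $f$ is identified with a continuous map on $[0,1]$ with $f(0)=f(1)$). Write $f_1\sim f_2$ if $f_1=f_2\circ\phi$ for an orientation-preserving or orientation-reversing homeomorphism $\phi:I\to I$. The curve space is $\mathcal C=(\mathcal F([0,1])/\!\sim)\sqcup(\mathcal F(\mathbb S^1)/\!\sim)$; elements of the first part are called open, of the second part closed. For $C\in\mathcal C$, the length $L(C)=L(f)$ and the trace $\Gamma_C=f(I)$ do not depend on the representative $f\in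 C$. Standing assumption: $L(C)>0$ for all curves considered. In set-theoretic expressions $C$ is identified with $\Gamma_C$. Arc-length representative and measure. An arc-length representative of $C$ is $\beta_C^{\mathrm{arc}}=f\circ s_f^{-1}$ on $[0,L(C)]$ (with $0\sim L(C)$ identified if $C$ is closed), for a representative $f$ of $C$; it is unique up to orientation reversal (open case), or up to circular shift and reversal (closed case). The arc-length probability measure is $\mu_C(B)=\frac1{L(C)}\int_0^{L(C)}\mathbf 1_B(\beta_C^{\mathrm{arc}}(s))\,ds$ for Borel $B\subseteq\mathbb R^2$; it depends only on $C$ and is assumed non-atomic. $\sigma$-algebra on $\mathcal C$. Let $C(I,\mathbb R^2)$ be the continuous maps with the supremum metric, and let $\sim_{\mathrm{arc}}$ identify $(\ell,\eta)$ and $(\ell,\eta')$ when $\eta,\eta'$ differ by orientation reversal (for $I=[0,1]$), or by circular shift and/or reversal (for $I=\mathbb S^1$). The map $\Phi$ sends $C$ to the class $[L(C),\beta_C^{\mathrm{arc}}(L(C)\,\cdot)]$ in $(0,\infty)\times C(I,\mathbb R^2)/\!\sim_{\mathrm{arc}}$ (with $I=[0,1]$ or $\mathbb S^1$ according as $C$ is open or closed; the target, the disjoint union over the two choices of $I$, carries the Borel $\sigma$-algebra of the quotient topology). $\mathcal C$ is equipped with the smallest $\sigma$-algebra making $\Phi$ measurable. Global band: $\mathcal R(A,B)=\{(1-\lambda)x+\lambda y: x\in\Gamma_A,\ y\in\Gamma_B,\ \lambda\in[0,1]\}$. Fast-walk (FW) band. Put $\beta_C(t)=\beta_C^{\mathrm{arc}}(L(C)t)$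 on $[0,1]$ or $\mathbb S^1$. If $C$ is open, $\mathcal G(C)=\{\beta_C,\beta_C^{\leftarrow}\}$ with $\beta_C^{\leftarrow}(t)=\beta_C(1-t)$. If $C$ is closed, $\mathcal G(C)=\{\beta_C^\theta,(\beta_C^\theta)^{\leftarrow}:\theta\in\mathbb S^1\}$ with $\beta_C^\theta(t)=\beta_C(t+\theta \bmod 1)$ and $(\beta_C^\theta)^{\leftarrow}(t)=\beta_C(\theta-t \bmod 1)$ (so each element has equal values at $0$ and $1$). For $\alpha\in\mathcal G(A)$, $\beta\in\mathcal G(B)$, let $\gamma_{\alpha,\beta}:\mathbb S^1\to\mathbb R^2$ be the closed loop obtained by concatenating $\alpha$ on $[0,1]$, the segment from $\alpha(1)$ to $\beta(1)$, $\beta$ traversed in reverse, and the segment from $\beta(0)$ to $\alpha(0)$ (each on a quarter of $\mathbb S^1$), and let $W(\alpha,\beta)$ be its image. For $p\notin W(\alpha,\beta)$ let $n_2(\gamma_{\alpha,\beta};p)\in\{0,1\}$ be the degree of $t\mapsto(\gamma_{\alpha,\beta}(t)-p)/\|\gamma_{\alpha,\beta}(t)-p\|$ reduced mod $2$. Set $E(\alpha,\beta)=W(\alpha,\beta)\cup\{p\notin W(\alpha,\beta): n_2(\gamma_{\alpha,\beta};p)=1\}$ and $\Delta(\alpha,\beta)=\|\alpha(1)-\beta(1)\|_2+\|\alpha(0)-\beta(0)\|_2$; let $\mathcal M(A,B)$ be the set of minimizers of $\Delta$ over $\mathcal G(A)\times\mathcal G(B)$. The FW band is $R_{\mathrm{FW}}(A,B)=\mathrm{cl}\bigl(\bigcup_{(\alpha,\beta)\in\mathcal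 M(A,B)}E(\alpha,\beta)\bigr)$. Depths. For a band $\mathcal R_b\in\{\mathcal R,R_{\mathrm{FW}}\}$: the integral depth is $\binom n2^{-1}\sum_{1\le i<j\le n}\mu_C(\mathcal R_b(C_i,C_j))$ and the infimal depth is $\binom n2^{-1}\sum_{1\le i<j\le n}\mathbf 1\{\mu_C(\mathcal R_b(C_i,C_j))=1\}$. For $\mathcal R_b=\mathcal R$ they are denoted $D_{\mathrm{int}}(C\mid\{C_i\})$ and $D_{\mathrm{inf}}(C\mid\{C_i\})$; for $\mathcal R_b=R_{\mathrm{FW}}$ they are denoted $D_{\mathrm{FW}}(C\mid\{C_i\})$ and $D_{\mathrm{FW}}^{\inf}(C\mid\{C_i\})$. *)

theory Defs
  imports "HOL-Analysis.Analysis" "HOL-Probability.Probability" "HOL-Homology.Homology"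
begin

type_synonym plane = "real^2"

section \<open>General topology and measure theory\<close>

definition quotient_topology :: "'a topology \<Rightarrow> ('a \<Rightarrow> 'b) \<Rightarrow> 'b topology" where
  "quotient_topology X q =
     topology (\<lambda>U. U \<subseteq> q ` topspace X \<and> openin X {x \<in> topspace X. q x \<in> U})"

lemma openin_quotient_topology:
  "openin (quotient_topology X q) U \<longleftrightarrow>
     U \<subseteq> q ` topspace X \<and> openin X {x \<in> topspace X. q x \<in> U}"
proof -
  have "istopology (\<lambda>U. U \<subseteq> q ` topspace X \<and> openin X {x \<in> topspace X. q x \<in> U})"
    unfolding istopology_def
  proof (intro conjI allI impI)
    fix S T
    assume "S \<subseteq> q ` topspace X \<and> openin X {x \<in> topspace X. q x \<in> S}"
      and "T \<subseteq> q ` topspace X \<and> openin X {x \<in> topspace X. q x \<in> T}"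
    moreover have "{x \<in> topspace X. q x \<in> S \<inter> T} =
        {x \<in> topspace X. q x \<in> S} \<inter> {x \<in> topspace X. q x \<in> T}"
      by auto
    ultimately show "S \<inter> T \<subseteq> q ` topspace X" "openin X {x \<in> topspace X. q x \<in> S \<inter> T}"
      by auto
  next
    fix \<K>
    assume K: "\<forall>U\<in>\<K>. U \<subseteq> q ` topspace X \<and> openin X {x \<in> topspace X. q x \<in> U}"
    then show "\<Union>\<K> \<subseteq> q ` topspace X" by blast
    have "{x \<in> topspace X. q x \<in> \<Union>\<K>} = (\<Union>U\<in>\<K>. {x \<in> topspace X. q x \<in> U})"
      by auto
    then show "openin X {x \<in> topspace X. q x \<in> \<Union>\<K>}"
      using K by (auto intro: openin_Union)
  qed
  then show ?thesis
    unfolding quotient_topology_def by (simp add: topology_inverse')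
qed

lemma topspace_quotient_topology [simp]: "topspace (quotient_topology X q) = q ` topspace X"
proof
  show "topspace (quotient_topology X q) \<subseteq> q ` topspace X"
    using openin_quotient_topology[of X q "topspace (quotient_topology X q)"] by simp
  have "{x \<in> topspace X. q x \<in> q ` topspace X} = topspace X" by auto
  then have "openin (quotient_topology X q) (q ` topspace X)"
    by (simp add: openin_quotient_topology)
  then show "q ` topspace X \<subseteq> topspace (quotient_topology X q)"
    by (rule openin_subset)
qed

lemma quotient_map_quotient_topology: "quotient_map X (quotient_topology X q) q"
  by (auto simp: quotient_map_def openin_quotient_topology)

definition borel_of :: "'a topology \<Rightarrow> 'a measure" where
  "borel_of T = sigma (topspace T) {U. openin T U}"

definition nonatomic :: "'a measure \<Rightarrow> bool" where
  "nonatomic M \<longleftrightarrow> (\<forall>A\<in>sets M. 0 < emeasure M A \<longrightarrow>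
     (\<exists>B\<in>sets M. B \<subseteq> A \<and> 0 < emeasure M B \<and> emeasure M B < emeasure M A))"

section \<open>Curve space\<close>

datatype domain = Unit_Interval | Circle

text \<open>The circle \<open>[0,1] / {0 ~ 1}\<close> has carrier \<open>{0..<1}\<close>: \<open>frac\<close> is injective on \<open>[0,1]\<close>
  except that it identifies \<open>0\<close> and \<open>1\<close>.\<close>

fun dom_proj :: "domain \<Rightarrow> real \<Rightarrow> real" where
  "dom_proj Unit_Interval = id"
| "dom_proj Circle = frac"

definition dom_space :: "domain \<Rightarrow> real topology" where
  "dom_space I = quotient_topology (top_of_set {0..1}) (dom_proj I)"

text \<open>\<open>path_length g a b\<close> is the length of \<open>g\<close> restricted to \<open>[a,b]\<close>; the supremum is over all
  partitions \<open>a = \<tau> 0 < \<dots> < \<tau> J = b\<close>.\<close>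

definition path_length :: "(real \<Rightarrow> plane) \<Rightarrow> real \<Rightarrow> real \<Rightarrow> ennreal" where
  "path_length g a b =
     (SUP (J, \<tau>) \<in> {(J::nat, \<tau>::nat \<Rightarrow> real). \<tau> 0 = a \<and> \<tau> J = b \<and> (\<forall>j<J. \<tau> j < \<tau> (Suc j))}.
        ennreal (\<Sum>j=1..J. norm (g (\<tau> j) - g (\<tau> (j - 1)))))"

text \<open>A map \<open>f\<close> on \<open>I\<close> is viewed as the map \<open>f \<circ> dom_proj I\<close> on \<open>[0,1]\<close>.\<close>

definition arclen :: "domain \<Rightarrow> (real \<Rightarrow> plane) \<Rightarrow> real \<Rightarrow> real" where
  "arclen I f t = enn2real (path_length (f \<circ> dom_proj I) 0 t)"

definition param_curves :: "domain \<Rightarrow> (real \<Rightarrow> plane) set" where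
  "param_curves I = {f. continuous_map (dom_space I) euclidean f \<and>
     path_length (f \<circ> dom_proj I) 0 1 < \<infinity> \<and> strict_mono_on {0..1} (arclen I f)}"

text \<open>Every homeomorphism of \<open>[0,1]\<close> or of the circle either preserves or reverses orientation.
  Functions are only compared on the domain, so a class contains all (irrelevant) extensions of
  its members to the real line.\<close>

definition reparam :: "domain \<Rightarrow> ((real \<Rightarrow> plane) \<times> (real \<Rightarrow> plane)) set" where
  "reparam I = {(f, g). f \<in> param_curves I \<and> g \<in> param_curves I \<and>
     (\<exists>\<phi>. homeomorphic_map (dom_space I) (dom_space I) \<phi> \<and>
          (\<forall>t\<in>topspace (dom_space I). f t = g (\<phi> t)))}"

lemma equiv_reparam: "equiv (param_curves I) (reparam I)"
proof (rule equivI)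
  show "reparam I \<subseteq> param_curves I \<times> param_curves I"
    by (auto simp: reparam_def)
  show "refl_on (param_curves I) (reparam I)"
    by (auto simp: refl_on_def reparam_def intro!: exI[of _ id])
  show "sym (reparam I)"
  proof (rule symI)
    fix f g assume "(f, g) \<in> reparam I"
    then obtain \<phi> where fg: "f \<in> param_curves I" "g \<in> param_curves I"
      and h: "homeomorphic_map (dom_space I) (dom_space I) \<phi>"
      and e: "\<And>t. t \<in> topspace (dom_space I) \<Longrightarrow> f t = g (\<phi> t)"
      by (auto simp: reparam_def)
    obtain \<psi> where p: "homeomorphic_maps (dom_space I) (dom_space I) \<phi> \<psi>"
      using h homeomorphic_map_maps by blast
    then have "homeomorphic_map (dom_space I) (dom_space I) \<psi>"
      using homeomorphic_maps_sym homeomorphic_map_maps by blast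
    moreover have "g t = f (\<psi> t)" if "t \<in> topspace (dom_space I)" for t
      using p that e[of "\<psi> t"] unfolding homeomorphic_maps_def
      by (metis continuous_map_image_subset_topspace image_subset_iff)
    ultimately show "(g, f) \<in> reparam I"
      using fg by (auto simp: reparam_def)
  qed
  show "trans (reparam I)"
  proof (rule transI)
    fix f g h assume "(f, g) \<in> reparam I" "(g, h) \<in> reparam I"
    then obtain \<phi> \<psi> where fgh: "f \<in> param_curves I" "h \<in> param_curves I"
      and p: "homeomorphic_map (dom_space I) (dom_space I) \<phi>"
        "homeomorphic_map (dom_space I) (dom_space I) \<psi>"
      and e: "\<And>t. t \<in> topspace (dom_space I) \<Longrightarrow> f t = g (\<phi> t)"
        "\<And>t. t \<in> topspace (dom_space I) \<Longrightarrow> g t = h (\<psi> t)"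
      by (auto simp: reparam_def)
    have "homeomorphic_map (dom_space I) (dom_space I) (\<psi> \<circ> \<phi>)"
      using p homeomorphic_map_compose by blast
    moreover have "f t = h ((\<psi> \<circ> \<phi>) t)" if "t \<in> topspace (dom_space I)" for t
      using that e p(1) by (metis comp_apply homeomorphic_imp_surjective_map image_eqI)
    ultimately show "(f, h) \<in> reparam I"
      using fgh by (auto simp: reparam_def)
  qed
qed

type_synonym curve = "domain \<times> (real \<Rightarrow> plane) set"

text \<open>The disjoint union of the open curves (tag \<open>Unit_Interval\<close>) and the closed curves
  (tag \<open>Circle\<close>).\<close>

definition curve_space :: "curve set" where
  "curve_space = (SIGMA I:UNIV. param_curves I // reparam I)"

definition rep :: "curve \<Rightarrow> real \<Rightarrow> plane" where
  "rep C = (SOME f. f \<in> snd C)"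

lemma rep_in:
  assumes "C \<in> curve_space"
  shows "rep C \<in> snd C" "rep C \<in> param_curves (fst C)"
proof -
  from assms have C: "snd C \<in> param_curves (fst C) // reparam (fst C)"
    by (auto simp: curve_space_def)
  then have "snd C \<noteq> {}"
    using equiv_reparam in_quotient_imp_non_empty by blast
  then show "rep C \<in> snd C"
    unfolding rep_def by (simp add: some_in_eq)
  then show "rep C \<in> param_curves (fst C)"
    using C equiv_reparam in_quotient_imp_subset by blast
qed

definition curve_length :: "curve \<Rightarrow> real" where
  "curve_length C = arclen (fst C) (rep C) 1"

lemma curve_length_pos:
  assumes "C \<in> curve_space"
  shows "0 < curve_length C"
proof -
  have "arclen (fst C) (rep C) 0 < arclen (fst C) (rep C) 1"
    using rep_in(2)[OF assms] by (auto simp: param_curves_def monotone_on_def)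
  moreover have "0 \<le> arclen (fst C) (rep C) 0"
    by (simp add: arclen_def)
  ultimately show ?thesis
    by (simp add: curve_length_def)
qed

definition curve_trace :: "curve \<Rightarrow> plane set" where
  "curve_trace C = rep C ` topspace (dom_space (fst C))"

section \<open>Arc-length representative and arc-length measure\<close>

text \<open>\<open>f \<circ> s\<^sub>f\<^sup>-\<^sup>1\<close> on \<open>[0, L]\<close>; only its values on \<open>[0, L]\<close> are meaningful.\<close>

definition arc_rep :: "domain \<Rightarrow> (real \<Rightarrow> plane) \<Rightarrow> real \<Rightarrow> plane" where
  "arc_rep I f s = (f \<circ> dom_proj I) (the_inv_into {0..1} (arclen I f) s)"

definition arc_measure :: "domain \<Rightarrow> (real \<Rightarrow> plane) \<Rightarrow> plane measure" where
  "arc_measure I f = measure_of UNIV (sets borel)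
     (\<lambda>B. 1 / ennreal (arclen I f 1) *
          (\<integral>\<^sup>+s\<in>{0..arclen I f 1}. indicator B (arc_rep I f s) \<partial>lborel))"

lemma sets_arc_measure [simp]: "sets (arc_measure I f) = sets borel"
  using sets.sigma_sets_eq[of "borel :: plane measure"]
  by (simp add: arc_measure_def sets_measure_of)

lemma emeasure_arc_measure:
  assumes cont: "continuous_on {0..arclen I f 1} (arc_rep I f)" and B: "B \<in> sets borel"
  shows "emeasure (arc_measure I f) B = 1 / ennreal (arclen I f 1) *
    (\<integral>\<^sup>+s\<in>{0..arclen I f 1}. indicator B (arc_rep I f s) \<partial>lborel)"
proof -
  define L where "L = arclen I f 1"
  let ?b = "arc_rep I f"
  let ?N = "scale_measure (1 / ennreal L) (distr (restrict_space lborel {0..L}) borel ?b)"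
  have "sets (restrict_space lborel {0..L}) = sets (restrict_space borel {0..L})"
    by (rule sets_restrict_space_cong) simp
  then have b: "?b \<in> borel_measurable (restrict_space lborel {0..L})"
    using borel_measurable_continuous_on_restrict[OF cont[folded L_def]]
      measurable_cong_sets[OF _ refl] by blast
  have N: "emeasure ?N A = 1 / ennreal L * (\<integral>\<^sup>+s\<in>{0..L}. indicator A (?b s) \<partial>lborel)"
    if A: "A \<in> sets borel" for A
  proof -
    have "emeasure (distr (restrict_space lborel {0..L}) borel ?b) A =
        (\<integral>\<^sup>+x. indicator A x \<partial>distr (restrict_space lborel {0..L}) borel ?b)"
      using A by simp
    also have "\<dots> = (\<integral>\<^sup>+s. indicator A (?b s) \<partial>restrict_space lborel {0..L})"
      using b A by (intro nn_integral_distr) auto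
    also have "\<dots> = (\<integral>\<^sup>+s\<in>{0..L}. indicator A (?b s) \<partial>lborel)"
      by (subst nn_integral_restrict_space) auto
    finally show ?thesis by simp
  qed
  have sets_N: "sets ?N = sets borel"
    by simp
  then have space_N: "space ?N = UNIV"
    using sets_eq_imp_space_eq by fastforce
  have "measure_of (space ?N) (sets ?N) (emeasure ?N) = arc_measure I f"
    unfolding arc_measure_def L_def[symmetric] sets_N space_N
    using sets.sigma_sets_eq[of "borel :: plane measure"]
    by (intro measure_of_eq N) auto
  then show ?thesis
    using N[OF B] unfolding measure_of_of_measure L_def by metis
qed

definition \<mu> :: "curve \<Rightarrow> plane measure" where
  "\<mu> C = arc_measure (fst C) (rep C)"

definition unit_rep :: "curve \<Rightarrow> real \<Rightarrow> plane" where
  "unit_rep C t = arc_rep (fst C) (rep C) (curve_length C * t)"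

section \<open>The sigma-algebra on the curve space\<close>

text \<open>Identity and reversal of \<open>[0,1]\<close>; shifts of the circle and shifts composed with reversal.
  On \<open>Circle\<close> they are written on all of \<open>[0,1]\<close>, with equal values at \<open>0\<close> and \<open>1\<close>.\<close>

fun dom_symmetries :: "domain \<Rightarrow> (real \<Rightarrow> real) set" where
  "dom_symmetries Unit_Interval = {\<lambda>t. t, \<lambda>t. 1 - t}"
| "dom_symmetries Circle =
     (\<Union>\<theta>\<in>{0..<1}. {\<lambda>t. frac (t + \<theta>), \<lambda>t. frac (\<theta> - t)})"

definition cont_maps :: "domain \<Rightarrow> (real \<Rightarrow> plane) metric" where
  "cont_maps I = cfunspace (dom_space I) euclidean_metric"

definition arc_rel :: "domain \<Rightarrow> ((real \<times> (real \<Rightarrow> plane)) \<times> (real \<times> (real \<Rightarrow> plane))) set" where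
  "arc_rel I = {((l, \<eta>), (l', \<eta>')). l' = l \<and> l > 0 \<and>
     \<eta> \<in> mspace (cont_maps I) \<and> \<eta>' \<in> mspace (cont_maps I) \<and>
     (\<exists>\<sigma>\<in>dom_symmetries I. \<forall>t\<in>topspace (dom_space I). \<eta>' t = \<eta> (\<sigma> t))}"

definition arc_class :: "domain \<Rightarrow> real \<times> (real \<Rightarrow> plane) \<Rightarrow> (real \<times> (real \<Rightarrow> plane)) set" where
  "arc_class I x = arc_rel I `` {x}"

definition arc_quotient :: "domain \<Rightarrow> (real \<times> (real \<Rightarrow> plane)) set topology" where
  "arc_quotient I = quotient_topology
     (prod_topology (top_of_set {0<..}) (mtopology_of (cont_maps I))) (arc_class I)"

text \<open>The library's metric space of continuous maps consists of extensional functions, hence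
  the restriction.\<close>

definition \<Phi> :: "curve \<Rightarrow> domain \<times> (real \<times> (real \<Rightarrow> plane)) set" where
  "\<Phi> C = (fst C, arc_class (fst C)
            (curve_length C, restrict (unit_rep C) (topspace (dom_space (fst C)))))"

definition curve_algebra :: "curve measure" where
  "curve_algebra = vimage_algebra curve_space \<Phi> (borel_of (sum_topology arc_quotient UNIV))"

section \<open>Bands\<close>

definition global_band :: "curve \<Rightarrow> curve \<Rightarrow> plane set" where
  "global_band A B = {(1 - u) *\<^sub>R x + u *\<^sub>R y | x y u. x \<in> curve_trace A \<and> y \<in> curve_trace B \<and> u \<in> {0..1}}"

text \<open>The elements of \<open>orientations C\<close> are used on \<open>[0,1]\<close> only.\<close>

definition orientations :: "curve \<Rightarrow> (real \<Rightarrow> plane) set" where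
  "orientations C = (\<lambda>\<sigma>. unit_rep C \<circ> \<sigma>) ` dom_symmetries (fst C)"

definition fw_loop :: "(real \<Rightarrow> plane) \<Rightarrow> (real \<Rightarrow> plane) \<Rightarrow> real \<Rightarrow> plane" where
  "fw_loop \<alpha> \<beta> = (\<alpha> +++ linepath (\<alpha> 1) (\<beta> 1)) +++ (reversepath \<beta> +++ linepath (\<beta> 0) (\<alpha> 0))"

text \<open>The degree of a circle map is the library's Brouwer degree in dimension 1, transported
  along the homeomorphism \<open>t \<mapsto> (cos 2\<pi>t, sin 2\<pi>t)\<close> from \<open>[0,1] / {0 ~ 1}\<close> to the library's
  sphere, whose points are real sequences vanishing from index 2 on.\<close>

definition sphere_embed :: "plane \<Rightarrow> nat \<Rightarrow> real" where
  "sphere_embed v = (\<lambda>i. if i = 0 then v $ 1 else if i = 1 then v $ 2 else 0)"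

definition circle_point :: "real \<Rightarrow> nat \<Rightarrow> real" where
  "circle_point t = sphere_embed (vector [cos (2 * pi * t), sin (2 * pi * t)])"

definition circle_degree :: "(real \<Rightarrow> plane) \<Rightarrow> int" where
  "circle_degree u = Brouwer_degree2 1 (sphere_embed \<circ> u \<circ> inv_into {0..<1} circle_point)"

definition n2 :: "(real \<Rightarrow> plane) \<Rightarrow> plane \<Rightarrow> int" where
  "n2 \<gamma> p = circle_degree (\<lambda>t. (\<gamma> t - p) /\<^sub>R norm (\<gamma> t - p)) mod 2"

definition fw_region :: "(real \<Rightarrow> plane) \<Rightarrow> (real \<Rightarrow> plane) \<Rightarrow> plane set" where
  "fw_region \<alpha> \<beta> = path_image (fw_loop \<alpha> \<beta>) \<union>
     {p. p \<notin> path_image (fw_loop \<alpha> \<beta>) \<and> n2 (fw_loop \<alpha> \<beta>) p = 1}"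

definition endpoint_cost :: "(real \<Rightarrow> plane) \<Rightarrow> (real \<Rightarrow> plane) \<Rightarrow> real" where
  "endpoint_cost \<alpha> \<beta> = norm (\<alpha> 1 - \<beta> 1) + norm (\<alpha> 0 - \<beta> 0)"

definition fw_minimizers :: "curve \<Rightarrow> curve \<Rightarrow> ((real \<Rightarrow> plane) \<times> (real \<Rightarrow> plane)) set" where
  "fw_minimizers A B = {(\<alpha>, \<beta>) \<in> orientations A \<times> orientations B.
     \<forall>(\<alpha>', \<beta>') \<in> orientations A \<times> orientations B. endpoint_cost \<alpha> \<beta> \<le> endpoint_cost \<alpha>' \<beta>'}"

definition fw_band :: "curve \<Rightarrow> curve \<Rightarrow> plane set" where
  "fw_band A B = closure (\<Union>(\<alpha>, \<beta>) \<in> fw_minimizers A B. fw_region \<alpha> \<beta>)"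

section \<open>Depths\<close>

definition integral_depth ::
  "(curve \<Rightarrow> curve \<Rightarrow> plane set) \<Rightarrow> nat \<Rightarrow> (nat \<Rightarrow> curve) \<Rightarrow> curve \<Rightarrow> real" where
  "integral_depth R n Cs C = (1 / real (n choose 2)) *
     (\<Sum>(i, j) | 1 \<le> i \<and> i < j \<and> j \<le> n. measure (\<mu> C) (R (Cs i) (Cs j)))"

definition infimal_depth ::
  "(curve \<Rightarrow> curve \<Rightarrow> plane set) \<Rightarrow> nat \<Rightarrow> (nat \<Rightarrow> curve) \<Rightarrow> curve \<Rightarrow> real" where
  "infimal_depth R n Cs C = (1 / real (n choose 2)) *
     (\<Sum>(i, j) | 1 \<le> i \<and> i < j \<and> j \<le> n. of_bool (measure (\<mu> C) (R (Cs i) (Cs j)) = 1))"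

abbreviation D_int :: "nat \<Rightarrow> (nat \<Rightarrow> curve) \<Rightarrow> curve \<Rightarrow> real" where
  "D_int \<equiv> integral_depth global_band"

abbreviation D_inf :: "nat \<Rightarrow> (nat \<Rightarrow> curve) \<Rightarrow> curve \<Rightarrow> real" where
  "D_inf \<equiv> infimal_depth global_band"

abbreviation D_FW :: "nat \<Rightarrow> (nat \<Rightarrow> curve) \<Rightarrow> curve \<Rightarrow> real" where
  "D_FW \<equiv> integral_depth fw_band"

abbreviation D_FW_inf :: "nat \<Rightarrow> (nat \<Rightarrow> curve) \<Rightarrow> curve \<Rightarrow> real" where
  "D_FW_inf \<equiv> infimal_depth fw_band"

end

theory Submission
  imports Defs
begin

text \<open>The sample is fixed, so each band \<open>R (Cs i) (Cs j)\<close> is one fixed subset of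
  the plane, and C enters a depth only through \<open>measure (\<mu> C)\<close> of finitely many
  such sets. Once the bands are Borel, the hypothesis makes each of these values measurable in C,
  and finite sums, scaling and the test for the value 1 preserve measurability. The geometric
  content is thus that bands are Borel: \<open>compact_global_band\<close> and
  \<open>closed_fw_band\<close>.\<close>

lemma compact_curve_trace:
  assumes "C \<in> curve_space"
  shows "compact (curve_trace C)"
proof -
  \<comment> \<open>Both domains are quotients of [0,1], so compactness passes along the
    projection.\<close>
  have "compact_space (top_of_set {0..1::real})"
    by (simp add: compact_space_subtopology)
  then have "compact_space (dom_space (fst C))"
    unfolding dom_space_def
    using quotient_map_quotient_topology quotient_imp_continuous_map
      quotient_imp_surjective_map image_compactin compact_space_def by metis
  moreover have "continuous_map (dom_space (fst C)) euclidean (rep C)"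
    using rep_in(2)[OF assms] by (simp add: param_curves_def)
  ultimately have "compactin euclidean (rep C ` topspace (dom_space (fst C)))"
    using image_compactin compact_space_def by metis
  then show ?thesis
    by (simp add: curve_trace_def)
qed

text \<open>The band is the image of a compact product under a jointly continuous map of both
  endpoints and the weight.\<close>

lemma compact_global_band:
  assumes "A \<in> curve_space" "B \<in> curve_space"
  shows "compact (global_band A B)"
proof -
  have "global_band A B =
      (\<lambda>(x, y, u). (1 - u) *\<^sub>R x + u *\<^sub>R y) ` (curve_trace A \<times> curve_trace B \<times> {0..1})"
    unfolding global_band_def by force
  moreover have "compact \<dots>"
    using compact_curve_trace[OF assms(1)] compact_curve_trace[OF assms(2)]
    by (intro compact_continuous_image compact_Times)
      (auto simp: case_prod_unfold intro!: continuous_intros)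
  ultimately show ?thesis by simp
qed

text \<open>The outer closure makes the band Borel even when the union runs over uncountably many
  minimizers.\<close>

lemma closed_fw_band: "closed (fw_band A B)"
  by (simp add: fw_band_def)

text \<open>Keeping \<open>R\<close> abstract lets one argument serve both bands.\<close>

context
  fixes M :: "curve measure" and R :: "curve \<Rightarrow> curve \<Rightarrow> plane set"
    and n :: nat and Cs :: "nat \<Rightarrow> curve"
  assumes mu: "\<And>B. B \<in> sets borel \<Longrightarrow> (\<lambda>C. measure (\<mu> C) B) \<in> borel_measurable M"
    and band: "\<And>i j. i \<in> {1..n} \<Longrightarrow> j \<in> {1..n} \<Longrightarrow> R (Cs i) (Cs j) \<in> sets borel"
begin

lemma borel_measurable_integral_depth: "integral_depth R n Cs \<in> borel_measurable M"
  unfolding integral_depth_def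
  by (intro borel_measurable_times borel_measurable_const borel_measurable_sum)
    (auto intro!: mu band)

lemma borel_measurable_infimal_depth: "infimal_depth R n Cs \<in> borel_measurable M"
proof -
  \<comment> \<open>This is the indicator of the preimage of the Borel set {1} under a measurable
    real function.\<close>
  have "(\<lambda>C. of_bool (measure (\<mu> C) (R (Cs i) (Cs j)) = 1) :: real) \<in> borel_measurable M"
    if "i \<in> {1..n}" "j \<in> {1..n}" for i j
  proof -
    note [measurable] = mu[OF band[OF that]]
    show ?thesis
      unfolding of_bool_def by measurable
  qed
  then show ?thesis
    unfolding infimal_depth_def
    by (intro borel_measurable_times borel_measurable_const borel_measurable_sum) auto
qed

end

theorem theorem4p1:
  fixes n :: nat and Cs :: "nat \<Rightarrow> curve"
  assumes "n \<ge> 2"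
    and "\<forall>i\<in>{1..n}. Cs i \<in> curve_space"
    and "\<forall>C\<in>curve_space. prob_space (\<mu> C) \<and> nonatomic (\<mu> C) \<and>
           (\<forall>f\<in>snd C. arc_measure (fst C) f = \<mu> C)"
    and "\<forall>B\<in>sets borel. (\<lambda>C. measure (\<mu> C) B) \<in> borel_measurable curve_algebra"
  shows "(\<lambda>C. D_int n Cs C) \<in> borel_measurable curve_algebra \<and>
         (\<lambda>C. D_inf n Cs C) \<in> borel_measurable curve_algebra \<and>
         (\<lambda>C. D_FW n Cs C) \<in> borel_measurable curve_algebra \<and>
         (\<lambda>C. D_FW_inf n Cs C) \<in> borel_measurable curve_algebra"
proof -
  have mu: "(\<lambda>C. measure (\<mu> C) B) \<in> borel_measurable curve_algebra" if "B \<in> sets borel" for B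
    using assms(4) that by blast
  have global: "global_band (Cs i) (Cs j) \<in> sets borel" if "i \<in> {1..n}" "j \<in> {1..n}" for i j
    using compact_global_band assms(2) that by (intro borel_compact) blast
  have fw: "fw_band (Cs i) (Cs j) \<in> sets borel" for i j
    by (intro borel_closed closed_fw_band)
  show ?thesis
    by (intro conjI borel_measurable_integral_depth borel_measurable_infimal_depth mu global fw)
qed

end
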